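(* The set $\{w_M : M\in\mathcal I\}$ is a homogeneous basis for the subspace $P(C)$ of primitive elements of the matroid-minor coalgebra $C$; that is, it is a basis of the $K$-vector space $P(C)$, each element of which lies in $C_S$ for some $S\in\mathcal U$.
   Context: $K$ is a field. Fix an infinite set and let $\mathcal U$ be the set of its finite subsets. $M(S)$ means that $M$ is a matroid with ground set $S$. $\mathcal W$ is the set of all (labeled) matroids $M(S)$ with $S\in\mathcal U$. For a matroid $M(S)$ and $A\subseteq S$, $M|A$ is the restriction to $A$ and $M/A$ is the contraction, a matroid on $S\setminus A$. $\rho(M)$ denotes the rank of $M$. Free product: for matroids $M(S)$, $N(T)$ on disjoint sets, $M\mathbin{\Box}N$ is the matroid on $S\cup T$ whose bases are the sets $B\subseteq S\cup T$ with $|B|=\rho(M)+\rho(N)$ such that $B\cap S$ is independent in $M$ and $B\cap T$ spans $N$; this operation is associative. A matroid is irreducible if it is nonempty (has nonempty ground set) and is not a free product of two nonempty matroids; otherwise it is reducible. $\mathcal I$ is the set of irreducible matroids in $\mathcal W$. Weak order on $\mathcal W$ (rank-preserving): $M\le N$ means that $M$ and $N$ have the same ground set and every basis of $M$ is a basis of $N$. $\mu_{\mathcal W}$ is the Möbius function of the poset $\mathcal W$: $\mu(x,x)=1$ and $\mu(x,z)=-\sum_{x\le y<z}\mu(x,y)$ for $x<z$. For $M\in\mathcal W$, $\mathcal W_M=\{N\in\mathcal W: N\ge M\}$. The matroid-minor coalgebra $C$ is the $K$-vector space with basis $\mathcal W$, with coproduct $\delta(M)=\sum_{A\subseteq S}M|A\otimes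 M/A$ and counit $\epsilon(M)=1$ if $S=\emptyset$ and $0$ otherwise, for $M=M(S)\in\mathcal W$. $C_S$ is the span of the matroids with ground set $S$, so $C=\bigoplus_{S\in\mathcal U}C_S$. Writing $1$ for the empty matroid, $P(C)=\{x\in\ker\epsilon : \delta(x)=1\otimes x+x\otimes 1\}$. For $M\in\mathcal W$, $w_M=\sum_{N\in\mathcal W_M}\mu_{\mathcal W}(M,N)\,N\in C$. *)

theory Defs
  imports Complex_Main "HOL-Library.Poly_Mapping"
begin

record 'a matroid =
  ground :: "'a set"
  bases :: "'a set set"

locale matroid =
  fixes M :: "'a matroid"
  assumes finite_ground: "finite (ground M)"
    and bases_subset: "\<And>B. B \<in> bases M \<Longrightarrow> B \<subseteq> ground M"
    and bases_nonempty: "bases M \<noteq> {}"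
    and basis_exchange: "\<And>B B' x. \<lbrakk>B \<in> bases M; B' \<in> bases M; x \<in> B - B'\<rbrakk>
          \<Longrightarrow> \<exists>y \<in> B' - B. insert y (B - {x}) \<in> bases M"

definition indep :: "'a matroid \<Rightarrow> 'a set \<Rightarrow> bool" where
  "indep M I \<longleftrightarrow> (\<exists>B \<in> bases M. I \<subseteq> B)"

definition spanning :: "'a matroid \<Rightarrow> 'a set \<Rightarrow> bool" where
  "spanning M A \<longleftrightarrow> A \<subseteq> ground M \<and> (\<exists>B \<in> bases M. B \<subseteq> A)"

definition rank :: "'a matroid \<Rightarrow> nat" where
  "rank M = Max (card ` Collect (indep M))"

definition restriction :: "'a matroid \<Rightarrow> 'a set \<Rightarrow> 'a matroid" where
  "restriction M A =
     \<lparr>ground = A,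
      bases = {B. B \<subseteq> A \<and> indep M B \<and> (\<forall>I. I \<subseteq> A \<and> indep M I \<and> B \<subseteq> I \<longrightarrow> I = B)}\<rparr>"

text \<open>For a matroid, whether \<open>B \<union> B'\<close> is a basis does not depend on the choice of the
  basis \<open>B'\<close> of the restriction to \<open>A\<close>.\<close>

definition contraction :: "'a matroid \<Rightarrow> 'a set \<Rightarrow> 'a matroid" where
  "contraction M A =
     \<lparr>ground = ground M - A,
      bases = {B. B \<subseteq> ground M - A \<and> (\<exists>B' \<in> bases (restriction M A). B \<union> B' \<in> bases M)}\<rparr>"

definition empty_matroid :: "'a matroid" where
  "empty_matroid = \<lparr>ground = {}, bases = {{}}\<rparr>"

text \<open>Meaningful only for matroids with disjoint ground sets.\<close>

definition free_product :: "'a matroid \<Rightarrow> 'a matroid \<Rightarrow> 'a matroid" where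
  "free_product M N =
     \<lparr>ground = ground M \<union> ground N,
      bases = {B. B \<subseteq> ground M \<union> ground N \<and> card B = rank M + rank N \<and>
                  indep M (B \<inter> ground M) \<and> spanning N (B \<inter> ground N)}\<rparr>"

definition matroids :: "'a set \<Rightarrow> 'a matroid set" where
  "matroids X = {M. matroid M \<and> ground M \<subseteq> X}"

definition irreducible_matroids :: "'a set \<Rightarrow> 'a matroid set" where
  "irreducible_matroids X =
     {M \<in> matroids X. ground M \<noteq> {} \<and>
        \<not> (\<exists>N \<in> matroids X. \<exists>P \<in> matroids X. ground N \<noteq> {} \<and> ground P \<noteq> {} \<and>
              ground N \<inter> ground P = {} \<and> M = free_product N P)}"

definition weak_le :: "'a matroid \<Rightarrow> 'a matroid \<Rightarrow> bool" where
  "weak_le M N \<longleftrightarrow> ground M = ground N \<and> bases M \<subseteq> bases N"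

lemma finite_bases: "M \<in> matroids X \<Longrightarrow> finite (bases M)"
  by (rule finite_subset[of _ "Pow (ground M)"])
     (auto simp: matroids_def matroid_def)

lemma card_bases_less:
  assumes "N \<in> matroids X" "weak_le L N" "L \<noteq> N"
  shows "card (bases L) < card (bases N)"
  using assms by (intro psubset_card_mono finite_bases) (auto simp: weak_le_def)

lemma finite_matroids_on: "finite {N \<in> matroids X. ground N = S}"
proof (cases "finite S")
  case True
  have "{N \<in> matroids X. ground N = S} \<subseteq> (\<lambda>B. \<lparr>ground = S, bases = B\<rparr>) ` Pow (Pow S)"
  proof
    fix N assume N: "N \<in> {N \<in> matroids X. ground N = S}"
    then have "N = \<lparr>ground = S, bases = bases N\<rparr>" by simp
    moreover from N have "bases N \<in> Pow (Pow S)"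
      by (auto simp: matroids_def matroid_def)
    ultimately show "N \<in> (\<lambda>B. \<lparr>ground = S, bases = B\<rparr>) ` Pow (Pow S)" by blast
  qed
  then show ?thesis by (rule finite_subset) (use True in simp)
next
  case False
  then have "{N \<in> matroids X. ground N = S} = {}" by (auto simp: matroids_def matroid_def)
  then show ?thesis by (simp only: finite.emptyI)
qed

function mobius :: "'a set \<Rightarrow> 'a matroid \<Rightarrow> 'a matroid \<Rightarrow> int" where
  "mobius X M N =
     (if M \<in> matroids X \<and> N \<in> matroids X \<and> weak_le M N then
        if M = N then 1
        else - (\<Sum>L | L \<in> matroids X \<and> weak_le M L \<and> weak_le L N \<and> L \<noteq> N. mobius X M L)
      else 0)"
  by pat_completeness auto
termination
  by (relation "measure (\<lambda>(X, M, N). card (bases N))") (auto simp: card_bases_less)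

declare mobius.simps [simp del]

definition up_set :: "'a set \<Rightarrow> 'a matroid \<Rightarrow> 'a matroid set" where
  "up_set X M = {N \<in> matroids X. weak_le M N}"

lemma finite_up_set: "finite (up_set X M)"
  by (rule finite_subset[OF _ finite_matroids_on[of X "ground M"]])
     (auto simp: up_set_def weak_le_def)

text \<open>The vector space with basis \<open>B\<close> is modelled by the finitely supported functions on \<open>B\<close>.
  Accordingly, the tensor product of the spaces with bases \<open>B\<close> and \<open>B'\<close> is the
  space with basis \<open>B \<times> B'\<close>.\<close>

definition scale :: "'k::field \<Rightarrow> ('b \<Rightarrow>\<^sub>0 'k) \<Rightarrow> ('b \<Rightarrow>\<^sub>0 'k)" where
  "scale c x = Poly_Mapping.map ((*) c) x"

lemma lookup_scale [simp]: "Poly_Mapping.lookup (scale c x) b = c * Poly_Mapping.lookup x b"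
  by (simp add: scale_def Poly_Mapping.map.rep_eq when_def)

global_interpretation free: vector_space scale
  by standard (auto intro!: poly_mapping_eqI simp: lookup_add algebra_simps)

definition linear_extension ::
    "('b \<Rightarrow> 'c \<Rightarrow>\<^sub>0 'k) \<Rightarrow> ('b \<Rightarrow>\<^sub>0 'k::field) \<Rightarrow> 'c \<Rightarrow>\<^sub>0 'k" where
  "linear_extension f x = (\<Sum>b \<in> Poly_Mapping.keys x. scale (Poly_Mapping.lookup x b) (f b))"

definition tensor :: "('b \<Rightarrow>\<^sub>0 'k::field) \<Rightarrow> ('c \<Rightarrow>\<^sub>0 'k) \<Rightarrow> 'b \<times> 'c \<Rightarrow>\<^sub>0 'k" where
  "tensor x y = (\<Sum>b \<in> Poly_Mapping.keys x. \<Sum>c \<in> Poly_Mapping.keys y.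
     Poly_Mapping.single (b, c) (Poly_Mapping.lookup x b * Poly_Mapping.lookup y c))"

definition coalgebra_space :: "'a set \<Rightarrow> ('a matroid \<Rightarrow>\<^sub>0 'k::field) set" where
  "coalgebra_space X = free.span ((\<lambda>M. Poly_Mapping.single M 1) ` matroids X)"

definition homogeneous_component :: "'a set \<Rightarrow> 'a set \<Rightarrow> ('a matroid \<Rightarrow>\<^sub>0 'k::field) set" where
  "homogeneous_component X S =
     free.span ((\<lambda>M. Poly_Mapping.single M 1) ` {M \<in> matroids X. ground M = S})"

definition coproduct ::
    "('a matroid \<Rightarrow>\<^sub>0 'k::field) \<Rightarrow> 'a matroid \<times> 'a matroid \<Rightarrow>\<^sub>0 'k" where
  "coproduct = linear_extension (\<lambda>M. \<Sum>A \<in> Pow (ground M).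
     tensor (Poly_Mapping.single (restriction M A) 1) (Poly_Mapping.single (contraction M A) 1))"

definition counit :: "('a matroid \<Rightarrow>\<^sub>0 'k::field) \<Rightarrow> 'k" where
  "counit x = (\<Sum>M \<in> Poly_Mapping.keys x. Poly_Mapping.lookup x M * (if ground M = {} then 1 else 0))"

definition primitives :: "'a set \<Rightarrow> ('a matroid \<Rightarrow>\<^sub>0 'k::field) set" where
  "primitives X =
     {x \<in> coalgebra_space X. counit x = 0 \<and>
        coproduct x = tensor (Poly_Mapping.single empty_matroid 1) x +
                      tensor x (Poly_Mapping.single empty_matroid 1)}"

definition w_element :: "'a set \<Rightarrow> 'a matroid \<Rightarrow> 'a matroid \<Rightarrow>\<^sub>0 'k::field" where
  "w_element X M = (\<Sum>N \<in> up_set X M. scale (of_int (mobius X M N)) (Poly_Mapping.single N 1))"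

end

theory Submission
  imports Defs
begin

text \<open>Let \<open>\<zeta>\<^sub>M(x)\<close> be the sum of the coefficients of \<open>x\<close> at the matroids \<open>N \<le> M\<close>, so that
  \<open>\<zeta>\<^sub>N(w\<^sub>M)\<close> is 1 if \<open>M = N\<close> and 0 otherwise. For matroids \<open>P\<close>, \<open>Q\<close> on disjoint sets,
  \<open>N|P \<le> P\<close> and \<open>N/P \<le> Q\<close> hold iff \<open>N \<le> P \<box> Q\<close> and the ground set of \<open>P\<close> has rank \<open>\<rho>(P)\<close>
  in \<open>N\<close>; if \<open>N \<le> P \<box> Q\<close> and this rank is smaller, then \<open>N \<le> P' \<box> Q'\<close>, where \<open>P'\<close> is the truncation
  of \<open>P\<close> and \<open>Q'\<close> the elongation (dual truncation) of \<open>Q\<close>. Therefore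
  \<open>(\<zeta>\<^sub>P \<otimes> \<zeta>\<^sub>Q)(\<delta> x) = \<zeta>(x) - \<zeta>'(x)\<close> with \<open>\<zeta>\<close> taken at \<open>P \<box> Q\<close> and \<open>\<zeta>'\<close> at \<open>P' \<box> Q'\<close>, the second
  term being absent if \<open>\<rho>(P) = 0\<close> or \<open>Q\<close> is free. By induction on \<open>\<rho>(P)\<close>, \<open>x\<close> is primitive iff
  \<open>\<zeta>\<^sub>M(x) = 0\<close> for all \<open>M\<close> that are empty or reducible. As the \<open>\<zeta>\<^sub>M\<close> separate points, the primitive
  elements are spanned by the \<open>w\<^sub>M\<close> with \<open>M\<close> irreducible.\<close>

section \<open>Matroids and free products\<close>

lemma card_exchange:
  assumes "finite B" "x \<in> B" "y \<notin> B"
  shows "card (insert y (B - {x})) = card B"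
  using assms card_Suc_Diff1[of B x] by simp

context matroid
begin

lemma finite_subset_ground: "A \<subseteq> ground M \<Longrightarrow> finite A"
  using finite_ground finite_subset by blast

lemma finite_basis: "B \<in> bases M \<Longrightarrow> finite B"
  using bases_subset finite_subset_ground by blast

lemma indep_subset_ground: "indep M I \<Longrightarrow> I \<subseteq> ground M"
  using bases_subset by (auto simp: indep_def)

lemma finite_indep: "indep M I \<Longrightarrow> finite I"
  using indep_subset_ground finite_subset_ground by blast

lemma indep_mono: "indep M J \<Longrightarrow> I \<subseteq> J \<Longrightarrow> indep M I"
  by (auto simp: indep_def)

lemma indep_basis: "B \<in> bases M \<Longrightarrow> indep M B"
  by (auto simp: indep_def)

lemma indep_empty: "indep M {}"
  using bases_nonempty by (auto simp: indep_def)

text \<open>An exchange against \<open>B'\<close> preserves the size of \<open>B\<close> and makes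
  \<open>B - B'\<close> smaller. The process stops when \<open>B \<subseteq> B'\<close>, and then an
  element of \<open>B' - B\<close> would have nothing to be exchanged for.\<close>

lemma card_bases_eq:
  "B \<in> bases M \<Longrightarrow> B' \<in> bases M \<Longrightarrow> card B = card B'"
proof (induction "card (B - B')" arbitrary: B rule: less_induct)
  case less
  show ?case
  proof (cases "B \<subseteq> B'")
    case True
    moreover have "B' \<subseteq> B"
      using basis_exchange[OF less.prems(2,1)] True by blast
    ultimately show ?thesis by simp
  next
    case False
    then obtain x where x: "x \<in> B - B'" by blast
    then obtain y where y: "y \<in> B' - B" "insert y (B - {x}) \<in> bases M"
      using basis_exchange less.prems by blast
    have fin: "finite B" using less.prems finite_basis by blast
    have "insert y (B - {x}) - B' = (B - B') - {x}" using x y by auto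
    then have "card (insert y (B - {x}) - B') < card (B - B')"
      using fin x card_Diff1_less[of "B - B'" x] by simp
    then have "card (insert y (B - {x})) = card B'"
      using less.hyps y less.prems by blast
    moreover have "card (insert y (B - {x})) = card B"
      using x y fin by (intro card_exchange) auto
    ultimately show ?thesis by simp
  qed
qed

text \<open>Among the bases containing \<open>I\<close>, one with the fewest elements outside
  \<open>I \<union> B'\<close> has none there, as exchanging such an element against
  \<open>B'\<close> would keep \<open>I\<close> and lower that number.\<close>

lemma extend_to_basis:
  assumes "indep M I" "B' \<in> bases M"
  obtains B where "B \<in> bases M" "I \<subseteq> B" "B \<subseteq> I \<union> B'"
proof -
  obtain B0 where "B0 \<in> bases M \<and> I \<subseteq> B0" using assms by (auto simp: indep_def)
  from ex_has_least_nat[of "\<lambda>B. B \<in> bases M \<and> I \<subseteq> B", OF this, of "\<lambda>B. card (B - (I \<union> B'))"]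
  obtain B where B: "B \<in> bases M" "I \<subseteq> B"
    and least: "\<And>D. D \<in> bases M \<Longrightarrow> I \<subseteq> D \<Longrightarrow> card (B - (I \<union> B')) \<le> card (D - (I \<union> B'))"
    by metis
  have "B \<subseteq> I \<union> B'"
  proof (rule ccontr)
    assume "\<not> ?thesis"
    then obtain x where x: "x \<in> B" "x \<notin> I" "x \<notin> B'" by blast
    then obtain y where y: "y \<in> B' - B" "insert y (B - {x}) \<in> bases M"
      using basis_exchange[OF B(1) assms(2), of x] by blast
    have "insert y (B - {x}) - (I \<union> B') = (B - (I \<union> B')) - {x}" using x y by auto
    then have "card (insert y (B - {x}) - (I \<union> B')) < card (B - (I \<union> B'))"
      using finite_basis[OF B(1)] x card_Diff1_less[of "B - (I \<union> B')" x] by simp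
    moreover have "I \<subseteq> insert y (B - {x})" using B x by blast
    ultimately show False using least[OF y(2)] by simp
  qed
  with B that show thesis by blast
qed

lemma card_indep_le: "indep M I \<Longrightarrow> B \<in> bases M \<Longrightarrow> card I \<le> card B"
  by (metis card_bases_eq card_mono finite_basis indep_def)

lemma rank_eq_card_basis:
  assumes "B \<in> bases M"
  shows "rank M = card B"
proof -
  have "finite (Collect (indep M))"
    by (rule finite_subset[of _ "Pow (ground M)"])
      (use indep_subset_ground finite_ground in auto)
  then show ?thesis
    unfolding rank_def
    by (intro Max_eqI) (use assms card_indep_le indep_basis in auto)
qed

lemma card_indep_le_rank: "indep M I \<Longrightarrow> card I \<le> rank M"
  using bases_nonempty card_indep_le rank_eq_card_basis by (metis ex_in_conv)

lemma basis_if_indep_card: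
  assumes "indep M I" "card I = rank M"
  shows "I \<in> bases M"
proof -
  obtain B where "B \<in> bases M" "I \<subseteq> B" using assms by (auto simp: indep_def)
  then show ?thesis
    by (metis assms(2) card_subset_eq finite_basis rank_eq_card_basis)
qed

lemma spanning_card_ge_rank: "spanning M A \<Longrightarrow> rank M \<le> card A"
  unfolding spanning_def by (metis card_mono finite_subset_ground rank_eq_card_basis)

lemma basis_if_spanning_card:
  assumes "spanning M A" "card A = rank M"
  shows "A \<in> bases M"
proof -
  obtain B where "B \<in> bases M" "B \<subseteq> A" using assms by (auto simp: spanning_def)
  then show ?thesis
    by (metis assms card_subset_eq finite_subset_ground rank_eq_card_basis spanning_def)
qed

lemma spanning_mono: "spanning M A \<Longrightarrow> A \<subseteq> A' \<Longrightarrow> A' \<subseteq> ground M \<Longrightarrow> spanning M A'"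
  unfolding spanning_def by blast

text \<open>Let \<open>B'\<close> be a basis containing \<open>J\<close>, and extend
  \<open>I\<close> to a basis \<open>B\<close> inside \<open>I \<union> B'\<close>. If
  \<open>B\<close> missed \<open>J - I\<close>, it would have at most
  \<open>card I + card (B' - J)\<close> elements, fewer than \<open>B'\<close>.\<close>

lemma augment:
  assumes "indep M I" "indep M J" "card I < card J"
  obtains y where "y \<in> J - I" "indep M (insert y I)"
proof -
  obtain B' where B': "B' \<in> bases M" "J \<subseteq> B'" using assms by (auto simp: indep_def)
  obtain B where B: "B \<in> bases M" "I \<subseteq> B" "B \<subseteq> I \<union> B'"
    using extend_to_basis[OF assms(1) B'(1)] .
  have "B \<inter> (J - I) \<noteq> {}"
  proof
    assume "B \<inter> (J - I) = {}"
    then have "B \<subseteq> I \<union> (B' - J)" using B by blast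
    then have "card B \<le> card (I \<union> (B' - J))"
      using assms(1) B'(1) finite_indep finite_basis by (intro card_mono) auto
    also have "\<dots> \<le> card I + card (B' - J)" by (rule card_Un_le)
    also have "card (B' - J) = card B' - card J"
      using B' finite_basis finite_subset by (intro card_Diff_subset) blast+
    finally have "card B < card B'"
      using assms(3) card_indep_le[OF assms(2) B'(1)] by linarith
    then show False using card_bases_eq[OF B(1) B'(1)] by simp
  qed
  then obtain y where "y \<in> B" "y \<in> J - I" by blast
  with B that show thesis by (auto simp: indep_def)
qed

text \<open>Since \<open>B - {x}\<close> does not span, every basis inside \<open>B\<close> contains
  \<open>x\<close>. A basis exchange removing \<open>x\<close> therefore cannot stay inside
  \<open>B\<close>, which puts the new element outside \<open>B\<close>.\<close>

lemma spanning_exchange: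
  assumes "spanning M B" "spanning M B'" "x \<in> B - B'" "\<not> spanning M (B - {x})"
  obtains y where "y \<in> B' - B" "spanning M (insert y (B - {x}))"
proof -
  obtain D where D: "D \<in> bases M" "D \<subseteq> B" using assms by (auto simp: spanning_def)
  obtain D' where D': "D' \<in> bases M" "D' \<subseteq> B'" using assms by (auto simp: spanning_def)
  have notin: "\<not> E \<subseteq> B - {x}" if "E \<in> bases M" for E
    using assms(1,4) that by (auto simp: spanning_def)
  have "x \<in> D - D'" using notin[OF D(1)] D D' assms(3) by blast
  then obtain y where y: "y \<in> D' - D" "insert y (D - {x}) \<in> bases M"
    using basis_exchange[OF D(1) D'(1)] by metis
  have "y \<in> B' - B" using notin[OF y(2)] y D D' \<open>x \<in> D - D'\<close> by auto
  moreover from this have "insert y (B - {x}) \<subseteq> ground M" "insert y (D - {x}) \<subseteq> insert y (B - {x})"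
    using D assms(1,2) by (auto simp: spanning_def)
  then have "spanning M (insert y (B - {x}))"
    using y(2) unfolding spanning_def by blast
  ultimately show thesis by (rule that)
qed

section \<open>Restriction and contraction\<close>

lemma restriction_basis_iff:
  "I \<in> bases (restriction M A) \<longleftrightarrow>
     I \<subseteq> A \<and> indep M I \<and> (\<forall>J. J \<subseteq> A \<and> indep M J \<longrightarrow> card J \<le> card I)"
proof
  assume I: "I \<in> bases (restriction M A)"
  \<comment> \<open>Maximality under inclusion becomes maximality of size: a larger \<open>J\<close>
    would augment \<open>I\<close> within \<open>A\<close>.\<close>
  have "card J \<le> card I" if J: "J \<subseteq> A" "indep M J" for J
  proof (rule ccontr)
    assume "\<not> card J \<le> card I"
    moreover have IA: "indep M I" "I \<subseteq> A" using I by (auto simp: restriction_def)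
    ultimately obtain y where y: "y \<in> J - I" "indep M (insert y I)"
      using augment[of I J] J by (metis not_le)
    moreover from this have "insert y I \<subseteq> A" "I \<subseteq> insert y I" using J IA by auto
    ultimately have "insert y I = I" using I by (simp add: restriction_def)
    with y show False by blast
  qed
  with I show "I \<subseteq> A \<and> indep M I \<and> (\<forall>J. J \<subseteq> A \<and> indep M J \<longrightarrow> card J \<le> card I)"
    by (auto simp: restriction_def)
next
  assume "I \<subseteq> A \<and> indep M I \<and> (\<forall>J. J \<subseteq> A \<and> indep M J \<longrightarrow> card J \<le> card I)"
  then show "I \<in> bases (restriction M A)"
    unfolding restriction_def
    by simp (metis card_seteq finite_indep)
qed

lemma extend_to_restriction_basis:
  assumes "indep M I" "I \<subseteq> A"
  obtains J where "J \<in> bases (restriction M A)" "I \<subseteq> J"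
proof -
  \<comment> \<open>\<open>ex_has_greatest_nat\<close> wants a strict bound, hence the
    \<open>Suc\<close>.\<close>
  have "\<forall>J. indep M J \<and> J \<subseteq> A \<and> I \<subseteq> J \<longrightarrow> card J < Suc (rank M)"
    using card_indep_le_rank by (simp add: less_Suc_eq_le)
  moreover have "indep M I \<and> I \<subseteq> A \<and> I \<subseteq> I" using assms by simp
  ultimately have "\<exists>J. (indep M J \<and> J \<subseteq> A \<and> I \<subseteq> J) \<and>
      (\<forall>L. indep M L \<and> L \<subseteq> A \<and> I \<subseteq> L \<longrightarrow> card L \<le> card J)"
    by (intro ex_has_greatest_nat)
  then obtain J where J: "indep M J" "J \<subseteq> A" "I \<subseteq> J"
    and max: "\<And>L. indep M L \<Longrightarrow> L \<subseteq> A \<Longrightarrow> I \<subseteq> L \<Longrightarrow> card L \<le> card J"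
    by metis
  have "J \<in> bases (restriction M A)"
    unfolding restriction_def using J max
    by simp (metis card_seteq finite_indep subset_trans)
  with J that show thesis by blast
qed

lemma card_restriction_bases:
  "I \<in> bases (restriction M A) \<Longrightarrow> J \<in> bases (restriction M A) \<Longrightarrow> card I = card J"
  by (simp add: restriction_basis_iff antisym)

lemma indep_restriction_iff: "indep (restriction M A) I \<longleftrightarrow> I \<subseteq> A \<and> indep M I"
proof
  assume "indep (restriction M A) I"
  then show "I \<subseteq> A \<and> indep M I"
    unfolding indep_def[of "restriction M A"] by (fastforce simp: restriction_basis_iff intro: indep_mono)
next
  assume "I \<subseteq> A \<and> indep M I"
  then show "indep (restriction M A) I"
    using extend_to_restriction_basis unfolding indep_def[of "restriction M A"] by metis
qed

lemma matroid_restriction: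
  assumes "A \<subseteq> ground M"
  shows "matroid (restriction M A)"
proof
  show "finite (ground (restriction M A))"
    using assms finite_subset_ground by (simp add: restriction_def)
  show "bases (restriction M A) \<noteq> {}"
    using extend_to_restriction_basis[OF indep_empty, of A] by blast
  show "B \<subseteq> ground (restriction M A)" if "B \<in> bases (restriction M A)" for B
    using that by (simp add: restriction_def)
  fix B B' x
  assume B: "B \<in> bases (restriction M A)" and B': "B' \<in> bases (restriction M A)"
    and x: "x \<in> B - B'"
  have fin: "finite B" using B finite_indep by (simp add: restriction_def)
  have "card (B - {x}) < card B'"
    using card_restriction_bases[OF B B'] x fin by (metis DiffD1 card_Diff1_less)
  moreover have "indep M (B - {x})" "indep M B'"
    using B B' indep_mono by (auto simp: restriction_def)
  ultimately obtain y where y: "y \<in> B' - (B - {x})" "indep M (insert y (B - {x}))"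
    using augment by blast
  then have y': "y \<in> B' - B" using x by auto
  have "card (insert y (B - {x})) = card B"
    using x y' fin by (intro card_exchange) auto
  then have "insert y (B - {x}) \<in> bases (restriction M A)"
    using B B' y unfolding restriction_basis_iff by auto
  with y' show "\<exists>y\<in>B' - B. insert y (B - {x}) \<in> bases (restriction M A)" by blast
qed

text \<open>Extend \<open>D\<close> to a basis \<open>E\<close> using elements of \<open>B\<close>
  only. As \<open>E \<inter> A\<close> is independent and contains the maximal set \<open>D\<close>,
  it equals \<open>D\<close>, so everything added lies in \<open>B - A\<close>.\<close>

lemma extend_restriction_basis:
  assumes "D \<in> bases (restriction M A)" "B \<in> bases M"
  obtains C where "C \<subseteq> B - A" "C \<union> D \<in> bases M"
proof -
  have D: "indep M D" "D \<subseteq> A" using assms by (auto simp: restriction_def)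
  obtain E where E: "E \<in> bases M" "D \<subseteq> E" "E \<subseteq> D \<union> B"
    using extend_to_basis[OF D(1) assms(2)] .
  have "E \<inter> A = D"
    using assms(1) D E indep_mono[OF indep_basis[OF E(1)], of "E \<inter> A"]
    by (auto simp: restriction_def)
  then have "E - A \<subseteq> B - A" "(E - A) \<union> D = E" using E(3) by auto
  with E(1) have "E - A \<subseteq> B - A" "(E - A) \<union> D \<in> bases M" by simp_all
  then show thesis by (rule that)
qed

text \<open>The choice of the basis of the restriction does not matter: if \<open>C\<close>
  completes \<open>D'\<close>, then some \<open>C' \<subseteq> C\<close> completes \<open>D\<close>,
  and equal sizes of bases force \<open>C' = C\<close>. Later proofs can thus fix one
  \<open>D\<close> for all \<open>C\<close>.\<close>

lemma contraction_basis_iff: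
  assumes "D \<in> bases (restriction M A)"
  shows "C \<in> bases (contraction M A) \<longleftrightarrow> C \<subseteq> ground M - A \<and> C \<union> D \<in> bases M"
proof
  assume "C \<in> bases (contraction M A)"
  then obtain D' where C: "C \<subseteq> ground M - A" and D': "D' \<in> bases (restriction M A)"
    and CD': "C \<union> D' \<in> bases M" by (auto simp: contraction_def)
  obtain C' where C': "C' \<subseteq> (C \<union> D') - A" "C' \<union> D \<in> bases M"
    using extend_restriction_basis[OF assms CD'] .
  have sub: "D \<subseteq> A" "D' \<subseteq> A" using assms D' by (auto simp: restriction_def)
  have fin: "finite (C \<union> D')" "finite (C' \<union> D)" using CD' C' finite_basis by auto
  have "C' \<subseteq> C" using C' sub by blast
  moreover have "card C + card D' = card C' + card D"
    using card_bases_eq[OF CD' C'(2)] fin C C' sub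
    by (subst (asm) (1 2) card_Un_disjoint) auto
  then have "card C = card C'" using card_restriction_bases[OF assms D'] by simp
  ultimately have "C' = C" using fin by (metis card_subset_eq finite_Un)
  with C C' show "C \<subseteq> ground M - A \<and> C \<union> D \<in> bases M" by simp
next
  assume "C \<subseteq> ground M - A \<and> C \<union> D \<in> bases M"
  with assms show "C \<in> bases (contraction M A)" by (auto simp: contraction_def)
qed

lemma matroid_contraction: "matroid (contraction M A)"
proof
  obtain D where D: "D \<in> bases (restriction M A)"
    using extend_to_restriction_basis[OF indep_empty, of A] by blast
  then have DA: "D \<subseteq> A" by (auto simp: restriction_def)
  show "finite (ground (contraction M A))" using finite_ground by (simp add: contraction_def)
  show "B \<subseteq> ground (contraction M A)" if "B \<in> bases (contraction M A)" for B
    using that by (auto simp: contraction_def)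
  obtain B where B: "B \<in> bases M" using bases_nonempty by blast
  obtain C where "C \<subseteq> B - A" "C \<union> D \<in> bases M" using extend_restriction_basis[OF D B] .
  then have "C \<in> bases (contraction M A)"
    using contraction_basis_iff[OF D] bases_subset[OF B] by blast
  then show "bases (contraction M A) \<noteq> {}" by blast
  fix C C' x
  assume C: "C \<in> bases (contraction M A)" and C': "C' \<in> bases (contraction M A)"
    and x: "x \<in> C - C'"
  have sub: "C \<subseteq> ground M - A" "C' \<subseteq> ground M - A"
    and CD: "C \<union> D \<in> bases M" "C' \<union> D \<in> bases M"
    using C C' contraction_basis_iff[OF D] by auto
  have "x \<in> (C \<union> D) - (C' \<union> D)" using x sub DA by blast
  then obtain y where y: "y \<in> (C' \<union> D) - (C \<union> D)" "insert y (C \<union> D - {x}) \<in> bases M"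
    using basis_exchange[OF CD] by blast
  moreover have "insert y (C \<union> D - {x}) = insert y (C - {x}) \<union> D"
    using x sub DA by blast
  ultimately have "insert y (C - {x}) \<in> bases (contraction M A)"
    using contraction_basis_iff[OF D] sub by auto
  with y show "\<exists>y\<in>C' - C. insert y (C - {x}) \<in> bases (contraction M A)" by blast
qed

end

section \<open>The free product is a matroid\<close>

lemma ground_restriction [simp]: "ground (restriction M A) = A"
  by (simp add: restriction_def)

lemma ground_contraction [simp]: "ground (contraction M A) = ground M - A"
  by (simp add: contraction_def)

lemma ground_free_product [simp]: "ground (free_product M N) = ground M \<union> ground N"
  by (simp add: free_product_def)

lemma matroid_free_product:
  assumes "matroid P" "matroid Q" and disj: "ground P \<inter> ground Q = {}"
  shows "matroid (free_product P Q)"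
proof -
  interpret P: matroid P by fact
  interpret Q: matroid Q by fact
  let ?S = "ground P" and ?T = "ground Q"
  \<comment> \<open>Splitting the size of \<open>B\<close> over the two ground sets lets the
    exchange be studied separately on each side.\<close>
  have basis_iff: "B \<in> bases (free_product P Q) \<longleftrightarrow> B \<subseteq> ?S \<union> ?T \<and>
      card (B \<inter> ?S) + card (B \<inter> ?T) = rank P + rank Q \<and> indep P (B \<inter> ?S) \<and> spanning Q (B \<inter> ?T)"
    for B
  proof -
    have "card B = card (B \<inter> ?S) + card (B \<inter> ?T)" if "B \<subseteq> ?S \<union> ?T"
    proof -
      have "B = (B \<inter> ?S) \<union> (B \<inter> ?T)" using that by blast
      then have "card B = card ((B \<inter> ?S) \<union> (B \<inter> ?T))" by simp
      also have "\<dots> = card (B \<inter> ?S) + card (B \<inter> ?T)"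
        by (rule card_Un_disjoint) (use P.finite_ground Q.finite_ground disj in auto)
      finally show ?thesis .
    qed
    then show ?thesis by (auto simp: free_product_def)
  qed
  show ?thesis
  proof
    show "finite (ground (free_product P Q))" using P.finite_ground Q.finite_ground by simp
    show "B \<subseteq> ground (free_product P Q)" if "B \<in> bases (free_product P Q)" for B
      using that by (simp add: free_product_def)
    obtain BP BQ where BP: "BP \<in> bases P" and BQ: "BQ \<in> bases Q"
      using P.bases_nonempty Q.bases_nonempty by blast
    then have "(BP \<union> BQ) \<inter> ?S = BP" "(BP \<union> BQ) \<inter> ?T = BQ"
      using P.bases_subset Q.bases_subset disj by blast+
    moreover have "indep P BP" "spanning Q BQ" "BP \<subseteq> ?S" "BQ \<subseteq> ?T"
      using BP BQ P.bases_subset Q.bases_subset by (auto simp: indep_def spanning_def)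
    ultimately have "BP \<union> BQ \<in> bases (free_product P Q)"
      using P.rank_eq_card_basis[OF BP] Q.rank_eq_card_basis[OF BQ] by (auto simp: basis_iff)
    then show "bases (free_product P Q) \<noteq> {}" by blast
    fix B B' x
    assume B: "B \<in> bases (free_product P Q)" and B': "B' \<in> bases (free_product P Q)"
      and x: "x \<in> B - B'"
    define I J I' J' where "I = B \<inter> ?S" "J = B \<inter> ?T" "I' = B' \<inter> ?S" "J' = B' \<inter> ?T"
    note defs = this
    have IJ: "card I + card J = rank P + rank Q" "indep P I" "spanning Q J"
      and IJ': "card I' + card J' = rank P + rank Q" "indep P I'" "spanning Q J'"
      and sub: "B \<subseteq> ?S \<union> ?T" "B' \<subseteq> ?S \<union> ?T"
      using B B' by (auto simp: basis_iff defs)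
    have fin: "finite I" "finite J" "finite I'" "finite J'"
      using P.finite_ground Q.finite_ground by (auto simp: defs)
    have splits: "insert y (B - {x}) \<inter> ?S = (if y \<in> ?S then insert y (I - {x}) else I - {x})"
      "insert y (B - {x}) \<inter> ?T = (if y \<in> ?T then insert y (J - {x}) else J - {x})" for y
      by (auto simp: defs)
    \<comment> \<open>\<open>x\<close> leaves exactly one of the two parts, so inserting an element
      on either side restores the total.\<close>
    have card: "card (I - {x}) + card (J - {x}) + 1 = rank P + rank Q"
    proof (cases "x \<in> ?S")
      case True
      then have "x \<in> I" "J - {x} = J" using x disj by (auto simp: defs)
      then show ?thesis using IJ(1) fin card_Suc_Diff1[of I x] by simp
    next
      case False
      then have "x \<in> J" "I - {x} = I" using x sub by (auto simp: defs)
      then show ?thesis using IJ(1) fin card_Suc_Diff1[of J x] by simp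
    qed
    show "\<exists>y\<in>B' - B. insert y (B - {x}) \<in> bases (free_product P Q)"
    proof -
      \<comment> \<open>\<open>S\<close> and \<open>T\<close> treat a replacement \<open>y\<close>
        in the ground set of \<open>P\<close> and of \<open>Q\<close>. In both, \<open>x\<close> may
        come from either side.\<close>
      have S: ?thesis
        if "y \<in> I' - I" "indep P (insert y (I - {x}))" "spanning Q (J - {x})" for y
      proof (rule bexI[of _ y])
        have "y \<in> ?S" "y \<notin> ?T" "y \<notin> I - {x}" using that disj by (auto simp: defs)
        then show "insert y (B - {x}) \<in> bases (free_product P Q)"
          using that fin card sub unfolding basis_iff splits by auto
      qed (use that in \<open>auto simp: defs\<close>)
      have T: ?thesis
        if "y \<in> J' - J" "indep P (I - {x})" "spanning Q (insert y (J - {x}))" for y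
      proof (rule bexI[of _ y])
        have "y \<notin> ?S" "y \<in> ?T" "y \<notin> J - {x}" using that disj by (auto simp: defs)
        then show "insert y (B - {x}) \<in> bases (free_product P Q)"
          using that fin card sub unfolding basis_iff splits by auto
      qed (use that in \<open>auto simp: defs\<close>)
      have indep: "indep P (I - {x})" using IJ(2) P.indep_mono by blast
      show ?thesis
      \<comment> \<open>If \<open>J - {x}\<close> still spans, any \<open>y\<close> in
        \<open>J' - J\<close> will do. If there is none, then \<open>J' \<subseteq> J - {x}\<close>,
        and the count leaves \<open>I'\<close> larger than \<open>I - {x}\<close>, so augmentation
        in \<open>P\<close> supplies \<open>y\<close>. If \<open>J - {x}\<close> does not span,
        \<open>x\<close> lies in \<open>J\<close> and spanning exchange in \<open>Q\<close> supplies
        \<open>y\<close>.\<close>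
      proof (cases "spanning Q (J - {x})")
        case True
        show ?thesis
        proof (cases "J' \<subseteq> J")
          case False
          then obtain y where y: "y \<in> J' - J" by blast
          then have "spanning Q (insert y (J - {x}))"
            by (intro Q.spanning_mono[OF True]) (auto simp: defs)
          with y indep show ?thesis by (blast intro: T)
        next
          case J: True
          then have "J' \<subseteq> J - {x}" using x by (auto simp: defs)
          then have "card J' \<le> card (J - {x})" using fin by (simp add: card_mono)
          then have "card (I - {x}) < card I'" using card IJ'(1) by linarith
          then obtain y where y: "y \<in> I' - (I - {x})" "indep P (insert y (I - {x}))"
            using P.augment[OF indep IJ'(2)] by blast
          then have "y \<in> I' - I" using x by (auto simp: defs)
          then show ?thesis using S y True by blast
        qed
      next
        case False
        then have "x \<in> J" using IJ(3) by (metis Diff_empty Diff_insert0)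
        then have "x \<in> J - J'" using x by (auto simp: defs)
        then obtain y where "y \<in> J' - J" "spanning Q (insert y (J - {x}))"
          using Q.spanning_exchange[OF IJ(3) IJ'(3) _ False] by blast
        then show ?thesis using T indep by blast
      qed
    qed
  qed
qed

section \<open>Truncation and elongation\<close>

definition truncation :: "'a matroid \<Rightarrow> 'a matroid" where
  "truncation M = \<lparr>ground = ground M, bases = {B. indep M B \<and> Suc (card B) = rank M}\<rparr>"

text \<open>The dual of the elongation is the truncation of the dual. There are no bases if
  \<open>rank M = card (ground M)\<close>, just as a truncation has none in rank 0; the
  \<open>Suc\<close> in \<open>truncation\<close> avoids a cut-off subtraction there.\<close>

definition elongation :: "'a matroid \<Rightarrow> 'a matroid" where
  "elongation M = \<lparr>ground = ground M, bases = {B. spanning M B \<and> card B = Suc (rank M)}\<rparr>"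

lemma ground_truncation [simp]: "ground (truncation M) = ground M"
  by (simp add: truncation_def)

lemma ground_elongation [simp]: "ground (elongation M) = ground M"
  by (simp add: elongation_def)

context matroid
begin

text \<open>A basis containing a set \<open>I\<close> of size below the rank has an element outside
  \<open>I\<close>; deleting it leaves a basis of the truncation around \<open>I\<close>.\<close>

lemma indep_truncation_iff:
  "indep (truncation M) I \<longleftrightarrow> indep M I \<and> card I < rank M"
proof
  assume "indep (truncation M) I"
  then obtain B where B: "indep M B" "Suc (card B) = rank M" "I \<subseteq> B"
    by (auto simp: truncation_def indep_def[of "\<lparr>ground = _, bases = _\<rparr>"])
  then have "card I \<le> card B" using finite_indep by (simp add: card_mono)
  with B indep_mono show "indep M I \<and> card I < rank M" by auto
next
  assume I: "indep M I \<and> card I < rank M"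
  then obtain B where B: "B \<in> bases M" "I \<subseteq> B" by (auto simp: indep_def)
  then have "I \<noteq> B" using I rank_eq_card_basis[of B] by auto
  then obtain x where x: "x \<in> B" "x \<notin> I" using B by blast
  then have "indep M (B - {x})" "Suc (card (B - {x})) = rank M" "I \<subseteq> B - {x}"
    using B card_Suc_Diff1[OF finite_basis[OF B(1)] x(1)] rank_eq_card_basis[OF B(1)]
    by (auto simp: indep_def)
  then show "indep (truncation M) I"
    by (auto simp: truncation_def indep_def[of "\<lparr>ground = _, bases = _\<rparr>"])
qed

lemma matroid_truncation:
  assumes "0 < rank M"
  shows "matroid (truncation M)"
proof
  show "finite (ground (truncation M))" by (simp add: finite_ground)
  show "B \<subseteq> ground (truncation M)" if "B \<in> bases (truncation M)" for B
    using that indep_subset_ground by (simp add: truncation_def)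
  show "bases (truncation M) \<noteq> {}"
    using indep_truncation_iff[of "{}"] indep_empty assms
    by (auto simp: indep_def[of "truncation M"])
  fix B B' x
  assume "B \<in> bases (truncation M)" "B' \<in> bases (truncation M)" and x: "x \<in> B - B'"
  then have B: "indep M B" "Suc (card B) = rank M" and B': "indep M B'" "Suc (card B') = rank M"
    by (auto simp: truncation_def)
  have fin: "finite B" using B finite_indep by blast
  have "card (B - {x}) < card B'"
    using B B' x fin by (metis DiffD1 card_Diff1_less old.nat.inject)
  moreover have "indep M (B - {x})" using B indep_mono by blast
  ultimately obtain y where y: "y \<in> B' - (B - {x})" "indep M (insert y (B - {x}))"
    using augment B' by blast
  then have y': "y \<in> B' - B" using x by auto
  have "card (insert y (B - {x})) = card B"
    using x y' fin by (intro card_exchange) auto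
  with B y y' show "\<exists>y\<in>B' - B. insert y (B - {x}) \<in> bases (truncation M)"
    by (auto simp: truncation_def)
qed

text \<open>Dually, a spanning set larger than the rank contains a basis and one more element, which
  together form a basis of the elongation.\<close>

lemma spanning_elongation_iff:
  "spanning (elongation M) A \<longleftrightarrow> spanning M A \<and> rank M < card A"
proof
  assume "spanning (elongation M) A"
  then obtain B where B: "spanning M B" "card B = Suc (rank M)" "B \<subseteq> A" "A \<subseteq> ground M"
    by (auto simp: elongation_def spanning_def[of "\<lparr>ground = _, bases = _\<rparr>"])
  then have "card B \<le> card A" by (intro card_mono finite_subset_ground)
  with B spanning_mono show "spanning M A \<and> rank M < card A" by auto
next
  assume A: "spanning M A \<and> rank M < card A"
  then obtain B where B: "B \<in> bases M" "B \<subseteq> A" "A \<subseteq> ground M" by (auto simp: spanning_def)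
  then have "A \<noteq> B" using A rank_eq_card_basis[of B] by auto
  then obtain x where x: "x \<in> A" "x \<notin> B" using B by blast
  then have "spanning M (insert x B)" "card (insert x B) = Suc (rank M)" "insert x B \<subseteq> A"
    using B finite_basis[OF B(1)] rank_eq_card_basis[OF B(1)]
    by (auto simp: spanning_def)
  with B show "spanning (elongation M) A"
    by (auto simp: elongation_def spanning_def[of "\<lparr>ground = _, bases = _\<rparr>"])
qed

lemma spanning_ground: "spanning M (ground M)"
  using bases_nonempty bases_subset by (auto simp: spanning_def)

lemma matroid_elongation:
  assumes "rank M < card (ground M)"
  shows "matroid (elongation M)"
proof
  show "finite (ground (elongation M))" by (simp add: finite_ground)
  show "B \<subseteq> ground (elongation M)" if "B \<in> bases (elongation M)" for B
    using that by (simp add: elongation_def spanning_def)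
  show "bases (elongation M) \<noteq> {}"
    using spanning_elongation_iff[of "ground M"] spanning_ground assms
    by (auto simp: spanning_def[of "elongation M"])
  fix B B' x
  assume "B \<in> bases (elongation M)" "B' \<in> bases (elongation M)" and x: "x \<in> B - B'"
  then have B: "spanning M B" "card B = Suc (rank M)"
    and B': "spanning M B'" "card B' = Suc (rank M)"
    by (auto simp: elongation_def)
  have fin: "finite B" "finite B'" using B B' finite_subset_ground by (auto simp: spanning_def)
  obtain y where y: "y \<in> B' - B" "spanning M (insert y (B - {x}))"
  proof (cases "spanning M (B - {x})")
    case True
    \<comment> \<open>\<open>B\<close> and \<open>B'\<close> have the same size and differ in
      \<open>x\<close>, so a new element exists; as \<open>B - {x}\<close> already spans, any one
      will do.\<close>
    have "\<not> B' \<subseteq> B"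
    proof
      assume "B' \<subseteq> B"
      then have "B' = B" using B B' fin by (simp add: card_subset_eq)
      with x show False by blast
    qed
    then obtain y where "y \<in> B' - B" by blast
    moreover from this have "spanning M (insert y (B - {x}))"
      using B' by (intro spanning_mono[OF True]) (use B in \<open>auto simp: spanning_def\<close>)
    ultimately show thesis by (rule that)
  next
    case False
    show thesis using spanning_exchange[OF B(1) B'(1) x False] that .
  qed
  have "card (insert y (B - {x})) = card B"
    using x y fin by (intro card_exchange) auto
  with B y show "\<exists>y\<in>B' - B. insert y (B - {x}) \<in> bases (elongation M)"
    by (auto simp: elongation_def)
qed

lemma rank_truncation:
  assumes "0 < rank M"
  shows "Suc (rank (truncation M)) = rank M"
proof -
  interpret T: matroid "truncation M" using assms by (rule matroid_truncation)
  obtain B where "B \<in> bases (truncation M)" using T.bases_nonempty by blast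
  from T.rank_eq_card_basis[OF this] this show ?thesis by (auto simp: truncation_def)
qed

lemma rank_elongation:
  assumes "rank M < card (ground M)"
  shows "rank (elongation M) = Suc (rank M)"
proof -
  interpret E: matroid "elongation M" using assms by (rule matroid_elongation)
  obtain B where "B \<in> bases (elongation M)" using E.bases_nonempty by blast
  from E.rank_eq_card_basis[OF this] this show ?thesis by (auto simp: elongation_def)
qed

lemma rank_le_card_ground: "rank M \<le> card (ground M)"
  using spanning_card_ge_rank[OF spanning_ground] .

end

section \<open>The weak order, minors and free products\<close>

lemma weak_le_refl [simp]: "weak_le M M"
  by (simp add: weak_le_def)

lemma weak_le_trans: "weak_le L M \<Longrightarrow> weak_le M N \<Longrightarrow> weak_le L N"
  by (auto simp: weak_le_def)

lemma weak_le_antisym: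
  "weak_le M N \<Longrightarrow> weak_le N (M :: 'a matroid) \<Longrightarrow> M = N"
  by (simp add: weak_le_def)

text \<open>From left to right, a basis \<open>B\<close> of \<open>N\<close> is compared with a
  basis \<open>E \<union> D\<close>, where \<open>D\<close> contains the trace of \<open>B\<close>
  on the ground set of \<open>P\<close> and \<open>E\<close> is part of the rest of
  \<open>B\<close>. Then \<open>D\<close> is a basis of \<open>P\<close> and \<open>E\<close> one of
  \<open>Q\<close>, so the trace is independent, the rest spans, and the size is right. From right
  to left, a basis \<open>C \<union> D\<close> of \<open>N\<close> has \<open>D\<close> independent
  in \<open>P\<close> and \<open>C\<close> spanning in \<open>Q\<close>; the rank condition gives
  both the right size, making them bases.\<close>

lemma minors_weak_le_iff:
  assumes "matroid N" "matroid P" "matroid Q"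
    and ground: "ground P \<inter> ground Q = {}" "ground N = ground P \<union> ground Q"
  shows "weak_le (restriction N (ground P)) P \<and> weak_le (contraction N (ground P)) Q \<longleftrightarrow>
    weak_le N (free_product P Q) \<and> rank (restriction N (ground P)) = rank P"
proof -
  interpret N: matroid N by fact
  interpret P: matroid P by fact
  interpret Q: matroid Q by fact
  let ?A = "ground P"
  have sub: "?A \<subseteq> ground N" and diff: "ground N - ?A = ground Q" using ground by auto
  interpret R: matroid "restriction N ?A" using sub by (rule N.matroid_restriction)
  show ?thesis
  proof (intro iffI conjI)
    assume "weak_le (restriction N ?A) P \<and> weak_le (contraction N ?A) Q"
    then have R: "bases (restriction N ?A) \<subseteq> bases P"
      and C: "bases (contraction N ?A) \<subseteq> bases Q" by (auto simp: weak_le_def)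
    show "rank (restriction N ?A) = rank P"
      using R R.bases_nonempty R.rank_eq_card_basis P.rank_eq_card_basis
      by (metis ex_in_conv subsetD)
    show "weak_le N (free_product P Q)"
      unfolding weak_le_def
    proof (intro conjI subsetI)
      show "ground N = ground (free_product P Q)" using ground by simp
      fix B assume B: "B \<in> bases N"
      then have "indep N (B \<inter> ?A)" by (auto simp: indep_def)
      then obtain D where D: "D \<in> bases (restriction N ?A)" "B \<inter> ?A \<subseteq> D"
        using N.extend_to_restriction_basis by (metis Int_lower2)
      obtain E where E: "E \<subseteq> B - ?A" "E \<union> D \<in> bases N"
        using N.extend_restriction_basis[OF D(1) B] .
      have BN: "B \<subseteq> ground N" using B N.bases_subset by blast
      then have EC: "E \<in> bases (contraction N ?A)" 
        using E by (subst N.contraction_basis_iff[OF D(1)]) auto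
      have "card B = card (E \<union> D)" using N.card_bases_eq[OF B E(2)] .
      also have "\<dots> = card E + card D"
        using E D(1) N.finite_basis[OF E(2)] by (intro card_Un_disjoint) (auto simp: restriction_def)
      also have "card E = rank Q" using EC C Q.rank_eq_card_basis[of E] by auto
      also have "card D = rank P" using D R P.rank_eq_card_basis[of D] by auto
      finally have "card B = rank P + rank Q" by simp
      moreover have "indep P (B \<inter> ?A)" using D R by (auto simp: indep_def)
      moreover have "spanning Q (B \<inter> ground Q)"
        using EC C E(1) BN ground by (auto simp: spanning_def intro!: bexI[of _ E])
      ultimately show "B \<in> bases (free_product P Q)"
        using BN ground by (simp add: free_product_def)
    qed
  next
    assume *: "weak_le N (free_product P Q) \<and> rank (restriction N ?A) = rank P"
    then have le: "bases N \<subseteq> bases (free_product P Q)" and rank: "rank (restriction N ?A) = rank P"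
      by (auto simp: weak_le_def)
    have basis: "D \<in> bases P" if D: "D \<in> bases (restriction N ?A)" for D
    proof -
      obtain B where B: "B \<in> bases N" using N.bases_nonempty by blast
      obtain E where E: "E \<subseteq> B - ?A" "E \<union> D \<in> bases N"
        using N.extend_restriction_basis[OF D B] .
      have "(E \<union> D) \<inter> ?A = D" using E D by (auto simp: restriction_def)
      then have "indep P D" using E le by (auto simp: free_product_def)
      then show ?thesis using R.rank_eq_card_basis[OF D] rank P.basis_if_indep_card by simp
    qed
    then show "weak_le (restriction N ?A) P" by (auto simp: weak_le_def)
    have "C \<in> bases Q" if C: "C \<in> bases (contraction N ?A)" for C
    proof -
      obtain D where D: "D \<in> bases (restriction N ?A)" using R.bases_nonempty by blast
      have CD: "C \<subseteq> ground Q" "C \<union> D \<in> bases N"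
        using C N.contraction_basis_iff[OF D] diff by auto
      have DA: "D \<subseteq> ?A" using D by (simp add: restriction_def)
      have "(C \<union> D) \<inter> ground Q = C" using CD DA ground by blast
      then have sp: "spanning Q C" and "card (C \<union> D) = rank P + rank Q"
        using CD le by (auto simp: free_product_def)
      moreover have "card (C \<union> D) = card C + card D"
        using CD DA ground N.finite_basis[OF CD(2)] by (intro card_Un_disjoint) auto
      moreover have "card D = rank P" using R.rank_eq_card_basis[OF D] rank by simp
      ultimately show ?thesis using Q.basis_if_spanning_card by simp
    qed
    then show "weak_le (contraction N ?A) Q" using diff by (auto simp: weak_le_def)
  qed
qed

text \<open>Below \<open>free_product P Q\<close> the rank on the ground set of \<open>P\<close> is
  at most \<open>rank P\<close>. If it is smaller, every basis of \<open>N\<close> has fewer than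
  \<open>rank P\<close> elements there, hence more than \<open>rank Q\<close> in the ground set of
  \<open>Q\<close>. These are the size conditions that truncation and elongation add, while the
  total rank stays the same.\<close>

lemma weak_le_free_product_truncation_iff:
  assumes "matroid N" "matroid P" "matroid Q"
    and ground: "ground P \<inter> ground Q = {}" "ground N = ground P \<union> ground Q"
  shows "weak_le N (free_product P Q) \<and> rank (restriction N (ground P)) \<noteq> rank P \<longleftrightarrow>
    0 < rank P \<and> rank Q < card (ground Q) \<and>
    weak_le N (free_product (truncation P) (elongation Q))"
proof -
  interpret N: matroid N by fact
  interpret P: matroid P by fact
  interpret Q: matroid Q by fact
  let ?A = "ground P"
  have sub: "?A \<subseteq> ground N" using ground by auto
  interpret R: matroid "restriction N ?A" using sub by (rule N.matroid_restriction)
  \<comment> \<open>A bound on the rank of the restriction bounds the traces of all bases at once;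
    conversely, the basis \<open>E \<union> D\<close> below has a trace attaining that rank.\<close>
  have rank_ge: "card (B \<inter> ?A) \<le> rank (restriction N ?A)" if "B \<in> bases N" for B
    using that by (intro R.card_indep_le_rank) (auto simp: N.indep_restriction_iff indep_def[of N])
  obtain D where D: "D \<in> bases (restriction N ?A)" using R.bases_nonempty by blast
  obtain B0 where "B0 \<in> bases N" using N.bases_nonempty by blast
  then obtain E where E: "E \<subseteq> B0 - ?A" "E \<union> D \<in> bases N"
    using N.extend_restriction_basis[OF D] by blast
  have ED: "(E \<union> D) \<inter> ?A = D" using E D by (auto simp: restriction_def)
  have rank: "rank (restriction N ?A) = card D" using R.rank_eq_card_basis[OF D] .
  have card: "card B = card (B \<inter> ?A) + card (B \<inter> ground Q)" if "B \<in> bases N" for B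
  proof -
    have "B = (B \<inter> ?A) \<union> (B \<inter> ground Q)" using N.bases_subset[OF that] ground by blast
    then have "card B = card ((B \<inter> ?A) \<union> (B \<inter> ground Q))" by simp
    also have "\<dots> = card (B \<inter> ?A) + card (B \<inter> ground Q)"
      by (rule card_Un_disjoint) (use P.finite_ground Q.finite_ground ground in auto)
    finally show ?thesis .
  qed
  show ?thesis
  proof (intro iffI conjI)
    assume *: "weak_le N (free_product P Q) \<and> rank (restriction N ?A) \<noteq> rank P"
    then have le: "B \<in> bases (free_product P Q)" if "B \<in> bases N" for B
      using that by (auto simp: weak_le_def)
    have "indep P D" using le[OF E(2)] ED by (auto simp: free_product_def)
    then have less: "rank (restriction N ?A) < rank P"
      using * rank P.card_indep_le_rank by fastforce
    then show pos: "0 < rank P" by simp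
    have B: "card B = rank P + rank Q" "indep P (B \<inter> ?A)" "spanning Q (B \<inter> ground Q)"
      "card (B \<inter> ?A) < rank P" "rank Q < card (B \<inter> ground Q)" if "B \<in> bases N" for B
      using le[OF that] rank_ge[OF that] less card[OF that] by (auto simp: free_product_def)
    have "card ((E \<union> D) \<inter> ground Q) \<le> card (ground Q)"
      using Q.finite_ground by (simp add: card_mono)
    then show less': "rank Q < card (ground Q)" using B(5)[OF E(2)] by simp
    show "weak_le N (free_product (truncation P) (elongation Q))"
      unfolding weak_le_def
    proof (intro conjI subsetI)
      show "ground N = ground (free_product (truncation P) (elongation Q))" using ground by simp
      fix B assume "B \<in> bases N"
      with B[OF this] N.bases_subset[OF this] P.rank_truncation[OF pos] Q.rank_elongation[OF less']
      show "B \<in> bases (free_product (truncation P) (elongation Q))"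
        using ground
        by (simp add: free_product_def P.indep_truncation_iff Q.spanning_elongation_iff)
    qed
  next
    assume *: "0 < rank P \<and> rank Q < card (ground Q) \<and>
      weak_le N (free_product (truncation P) (elongation Q))"
    then have B: "B \<subseteq> ground P \<union> ground Q" "card B = rank P + rank Q" "indep P (B \<inter> ?A)"
      "spanning Q (B \<inter> ground Q)" "card (B \<inter> ?A) < rank P" if "B \<in> bases N" for B
      using that P.rank_truncation Q.rank_elongation
      by (auto simp: weak_le_def free_product_def P.indep_truncation_iff Q.spanning_elongation_iff
          dest!: subsetD)
    then show "weak_le N (free_product P Q)"
      using ground by (auto simp: weak_le_def free_product_def)
    show "rank (restriction N ?A) \<noteq> rank P" using B(5)[OF E(2)] ED rank by simp
  qed
qed

section \<open>The coalgebra\<close>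

definition pairing :: "('b \<Rightarrow> 'k) \<Rightarrow> ('b \<Rightarrow>\<^sub>0 'k::field) \<Rightarrow> 'k" where
  "pairing g x = (\<Sum>b\<in>Poly_Mapping.keys x. Poly_Mapping.lookup x b * g b)"

text \<open>A common index set is what allows pairings of elements with different supports to be
  added.\<close>

lemma pairing_superset:
  assumes "finite K" "Poly_Mapping.keys x \<subseteq> K"
  shows "pairing g x = (\<Sum>b\<in>K. Poly_Mapping.lookup x b * g b)"
  unfolding pairing_def using assms
  by (intro sum.mono_neutral_left) (auto simp: in_keys_iff)

lemma pairing_cong:
  "(\<And>b. b \<in> Poly_Mapping.keys x \<Longrightarrow> g b = h b) \<Longrightarrow> pairing g x = pairing h x"
  unfolding pairing_def by (intro sum.cong) auto

lemma pairing_zero [simp]: "pairing g 0 = 0"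
  by (simp add: pairing_def)

lemma pairing_add: "pairing g (x + y) = pairing g x + pairing g y"
proof -
  let ?K = "Poly_Mapping.keys x \<union> Poly_Mapping.keys y"
  have "Poly_Mapping.keys (x + y) \<subseteq> ?K" by (rule Poly_Mapping.keys_add)
  then show ?thesis
    by (simp add: pairing_superset[of ?K] lookup_add distrib_right sum.distrib)
qed

lemma pairing_scale: "pairing g (scale c x) = c * pairing g x"
proof -
  have "Poly_Mapping.keys (scale c x) \<subseteq> Poly_Mapping.keys x" by (auto simp: in_keys_iff)
  then show ?thesis
    by (simp add: pairing_superset[of "Poly_Mapping.keys x"] sum_distrib_left mult.assoc)
qed

lemma pairing_diff: "pairing g (x - y) = pairing g x - pairing g y"
  using pairing_add[of g "x - y" y] by simp

lemma pairing_sum: "pairing g (\<Sum>i\<in>I. f i) = (\<Sum>i\<in>I. pairing g (f i))"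
  by (induction I rule: infinite_finite_induct) (auto simp: pairing_add)

lemma pairing_single [simp]: "pairing g (Poly_Mapping.single b c) = c * g b"
  by (simp add: pairing_superset[of "{b}"])

lemma pairing_linear_extension:
  "pairing g (linear_extension f x) = pairing (\<lambda>b. pairing g (f b)) x"
  by (simp add: linear_extension_def pairing_sum pairing_scale pairing_def[of _ x])

lemma pairing_tensor:
  "pairing g (tensor x y) = pairing (\<lambda>b. pairing (\<lambda>c. g (b, c)) y) x"
  by (simp add: tensor_def pairing_sum pairing_def[of _ x] pairing_def[of _ y]
      sum_distrib_left mult.assoc)

lemma pairing_mult_left: "pairing (\<lambda>b. c * g b) x = c * pairing g x"
  by (simp add: pairing_def sum_distrib_left mult.left_commute)

lemma pairing_mult_right: "pairing (\<lambda>b. g b * c) x = pairing g x * c"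
  by (simp add: pairing_def sum_distrib_right mult.assoc)

lemma pairing_diff_left: "pairing (\<lambda>b. g b - h b) x = pairing g x - pairing h x"
  by (simp add: pairing_def right_diff_distrib sum_subtractf)

text \<open>If \<open>z\<close> is nonzero, take a key \<open>b\<close> with least \<open>m\<close>.
  By \<open>mono\<close> no other key lies below \<open>b\<close>, so the sum at \<open>b\<close> is
  the coefficient at \<open>b\<close>, which is nonzero. This serves both the weak order and its
  product order on pairs.\<close>

lemma zero_if_order_sums_zero:
  fixes z :: "'b \<Rightarrow>\<^sub>0 'k::field" and m :: "'b \<Rightarrow> nat"
  assumes refl: "\<And>a. le a a"
    and mono: "\<And>a b. \<lbrakk>a \<in> Poly_Mapping.keys z; b \<in> Poly_Mapping.keys z; le a b; a \<noteq> b\<rbrakk> \<Longrightarrow> m a < m b"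
    and zero: "\<And>b. b \<in> Poly_Mapping.keys z \<Longrightarrow> pairing (\<lambda>a. of_bool (le a b)) z = 0"
  shows "z = 0"
proof (rule ccontr)
  assume "z \<noteq> 0"
  then obtain b0 where "b0 \<in> Poly_Mapping.keys z" by (metis equals0I keys_eq_empty)
  from ex_has_least_nat[of "\<lambda>b. b \<in> Poly_Mapping.keys z", OF this, of m]
  obtain b where b: "b \<in> Poly_Mapping.keys z"
    and least: "\<And>a. a \<in> Poly_Mapping.keys z \<Longrightarrow> m b \<le> m a" by metis
  have "pairing (\<lambda>a. of_bool (le a b)) z =
      (\<Sum>a\<in>Poly_Mapping.keys z. if a = b then Poly_Mapping.lookup z a else 0)"
    unfolding pairing_def
  proof (rule sum.cong)
    fix a assume a: "a \<in> Poly_Mapping.keys z"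
    then show "Poly_Mapping.lookup z a * of_bool (le a b) =
        (if a = b then Poly_Mapping.lookup z a else 0)"
      using refl mono[OF a b] least[OF a] by auto
  qed simp
  also have "\<dots> = Poly_Mapping.lookup z b" using b by simp
  finally show False using zero[OF b] b by (simp add: in_keys_iff)
qed

lemma keys_sum_subset:
  "(\<And>i. i \<in> I \<Longrightarrow> Poly_Mapping.keys (f i) \<subseteq> K) \<Longrightarrow> Poly_Mapping.keys (\<Sum>i\<in>I. f i) \<subseteq> K"
  by (rule order_trans[OF Poly_Mapping.keys_sum]) auto

lemma keys_scale: "Poly_Mapping.keys (scale c x) \<subseteq> Poly_Mapping.keys x"
  by (auto simp: in_keys_iff)

lemma keys_tensor:
  "Poly_Mapping.keys (tensor x y) \<subseteq> Poly_Mapping.keys x \<times> Poly_Mapping.keys y"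
  unfolding tensor_def by (intro keys_sum_subset) auto

lemma span_singles:
  "free.span ((\<lambda>b. Poly_Mapping.single b (1::'k::field)) ` W) = {x. Poly_Mapping.keys x \<subseteq> W}"
proof (intro set_eqI iffI)
  fix x :: "_ \<Rightarrow>\<^sub>0 'k" assume "x \<in> free.span ((\<lambda>b. Poly_Mapping.single b 1) ` W)"
  then show "x \<in> {x. Poly_Mapping.keys x \<subseteq> W}"
  proof (induction rule: free.span_induct_alt)
    case (step c y z)
    then have "Poly_Mapping.keys (scale c y) \<subseteq> W" using keys_scale[of c y] by auto
    then show ?case using step Poly_Mapping.keys_add[of "scale c y" z] by blast
  qed simp
next
  fix x :: "_ \<Rightarrow>\<^sub>0 'k" assume x: "x \<in> {x. Poly_Mapping.keys x \<subseteq> W}"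
  have "x = (\<Sum>b\<in>Poly_Mapping.keys x. scale (Poly_Mapping.lookup x b) (Poly_Mapping.single b 1))"
    by (rule poly_mapping_eqI)
      (simp add: lookup_sum lookup_single when_def if_distrib in_keys_iff cong: if_cong)
  also have "\<dots> \<in> free.span ((\<lambda>b. Poly_Mapping.single b 1) ` W)"
    using x by (intro free.span_sum free.span_scale free.span_base) auto
  finally show "x \<in> free.span ((\<lambda>b. Poly_Mapping.single b 1) ` W)" .
qed

section \<open>The coalgebra space, closure under the operations, and the empty matroid\<close>

lemma mem_coalgebra_space_iff: "x \<in> coalgebra_space X \<longleftrightarrow> Poly_Mapping.keys x \<subseteq> matroids X"
  by (simp add: coalgebra_space_def span_singles)

lemma mem_homogeneous_component_iff:
  "x \<in> homogeneous_component X S \<longleftrightarrow> Poly_Mapping.keys x \<subseteq> {M \<in> matroids X. ground M = S}"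
  by (simp add: homogeneous_component_def span_singles)

lemma restriction_mem_matroids:
  "M \<in> matroids X \<Longrightarrow> A \<subseteq> ground M \<Longrightarrow> restriction M A \<in> matroids X"
  by (auto simp: matroids_def matroid.matroid_restriction)

lemma contraction_mem_matroids: "M \<in> matroids X \<Longrightarrow> contraction M A \<in> matroids X"
  by (auto simp: matroids_def matroid.matroid_contraction)

lemma free_product_mem_matroids:
  "P \<in> matroids X \<Longrightarrow> Q \<in> matroids X \<Longrightarrow> ground P \<inter> ground Q = {} \<Longrightarrow>
     free_product P Q \<in> matroids X"
  by (auto simp: matroids_def matroid_free_product)

lemma empty_matroid_mem: "empty_matroid \<in> matroids X"
  by (auto simp: matroids_def matroid_def empty_matroid_def)

lemma ground_empty_matroid [simp]: "ground empty_matroid = {}"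
  by (simp add: empty_matroid_def)

lemma (in matroid) eq_empty_matroid_iff: "M = empty_matroid \<longleftrightarrow> ground M = {}"
proof
  assume "ground M = {}"
  then have "B = {}" if "B \<in> bases M" for B using bases_subset[OF that] by simp
  then have "bases M = {{}}" using bases_nonempty by blast
  with \<open>ground M = {}\<close> show "M = empty_matroid" by (simp add: empty_matroid_def)
qed simp

lemma rank_empty_matroid [simp]: "rank empty_matroid = 0"
proof -
  interpret matroid "empty_matroid :: 'a matroid"
    using empty_matroid_mem[of UNIV] by (simp add: matroids_def)
  show ?thesis using rank_le_card_ground by simp
qed

lemma indep_empty_matroid [simp]: "indep empty_matroid I \<longleftrightarrow> I = {}"
  by (simp add: indep_def empty_matroid_def)

lemma spanning_empty_matroid [simp]: "spanning empty_matroid A \<longleftrightarrow> A = {}"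
  by (auto simp: spanning_def empty_matroid_def)

lemma (in matroid) spanning_basis: "B \<in> bases M \<Longrightarrow> spanning M B"
  using bases_subset by (auto simp: spanning_def)

lemma free_product_empty_left:
  assumes "matroid M"
  shows "free_product empty_matroid M = M"
proof -
  interpret matroid M by fact
  have "B \<subseteq> ground M \<and> card B = rank M \<and> spanning M (B \<inter> ground M) \<longleftrightarrow> B \<in> bases M" for B
    by (metis Int_absorb2 bases_subset basis_if_spanning_card rank_eq_card_basis spanning_basis)
  then show ?thesis by (simp add: free_product_def)
qed

lemma free_product_empty_right:
  assumes "matroid M"
  shows "free_product M empty_matroid = M"
proof -
  interpret matroid M by fact
  have "B \<subseteq> ground M \<and> card B = rank M \<and> indep M (B \<inter> ground M) \<longleftrightarrow> B \<in> bases M" for B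
    by (metis Int_absorb2 bases_subset basis_if_indep_card rank_eq_card_basis indep_basis)
  then show ?thesis by (simp add: free_product_def)
qed

section \<open>Sums over down-sets and the coproduct\<close>

definition zeta :: "'a matroid \<Rightarrow> ('a matroid \<Rightarrow>\<^sub>0 'k::field) \<Rightarrow> 'k" where
  "zeta M = pairing (\<lambda>N. of_bool (weak_le N M))"

lemma zero_if_zeta_zero:
  assumes "x \<in> coalgebra_space X" "\<And>M. M \<in> matroids X \<Longrightarrow> zeta M x = 0"
  shows "x = 0"
proof (rule zero_if_order_sums_zero[where le = weak_le and m = "\<lambda>M. card (bases M)"])
  fix M N assume "M \<in> Poly_Mapping.keys x" "N \<in> Poly_Mapping.keys x" "weak_le M N" "M \<noteq> N"
  then show "card (bases M) < card (bases N)"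
    using assms(1) by (intro card_bases_less[of N X]) (auto simp: mem_coalgebra_space_iff)
next
  fix M assume "M \<in> Poly_Mapping.keys x"
  then show "pairing (\<lambda>N. of_bool (weak_le N M)) x = 0"
    using assms by (auto simp: mem_coalgebra_space_iff zeta_def)
qed simp

text \<open>The functional \<open>zeta P\<close> \<otimes> \<open>zeta Q\<close> on the tensor
  square; \<open>zeta2_tensor\<close> is the product formula.\<close>

definition zeta2 :: "'a matroid \<Rightarrow> 'a matroid \<Rightarrow> ('a matroid \<times> 'a matroid \<Rightarrow>\<^sub>0 'k::field) \<Rightarrow> 'k" where
  "zeta2 P Q = pairing (\<lambda>p. of_bool (weak_le (fst p) P \<and> weak_le (snd p) Q))"

lemma zeta2_add: "zeta2 P Q (x + y) = zeta2 P Q x + zeta2 P Q y"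
  by (simp add: zeta2_def pairing_add)

lemma zeta2_diff: "zeta2 P Q (x - y) = zeta2 P Q x - zeta2 P Q y"
  by (simp add: zeta2_def pairing_diff)

lemma zero_if_zeta2_zero:
  assumes keys: "Poly_Mapping.keys z \<subseteq> matroids X \<times> matroids X"
    and zero: "\<And>P Q. P \<in> matroids X \<Longrightarrow> Q \<in> matroids X \<Longrightarrow> zeta2 P Q z = 0"
  shows "z = 0"
proof (rule zero_if_order_sums_zero[where
      le = "\<lambda>p q. weak_le (fst p) (fst q) \<and> weak_le (snd p) (snd q)" and
      m = "\<lambda>p. card (bases (fst p)) + card (bases (snd p))"])
  fix p q assume pq: "p \<in> Poly_Mapping.keys z" "q \<in> Poly_Mapping.keys z"
    "weak_le (fst p) (fst q) \<and> weak_le (snd p) (snd q)" "p \<noteq> q"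
  then have q: "fst q \<in> matroids X" "snd q \<in> matroids X" using keys by auto
  have le: "card (bases L) \<le> card (bases N)" if "N \<in> matroids X" "weak_le L N" for L N :: "'a matroid"
    using card_bases_less[OF that] by (cases "L = N") auto
  consider "fst p \<noteq> fst q" | "snd p \<noteq> snd q" using pq(4) by (auto simp: prod_eq_iff)
  then show "card (bases (fst p)) + card (bases (snd p)) < card (bases (fst q)) + card (bases (snd q))"
  proof cases
    case 1
    then show ?thesis using card_bases_less[OF q(1)] le[OF q(2)] pq(3) by (simp add: add_less_le_mono)
  next
    case 2
    then show ?thesis using card_bases_less[OF q(2)] le[OF q(1)] pq(3) by (simp add: add_le_less_mono)
  qed
next
  fix q assume "q \<in> Poly_Mapping.keys z"
  then have "zeta2 (fst q) (snd q) z = 0" using keys by (intro zero) auto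
  then show "pairing (\<lambda>p. of_bool (weak_le (fst p) (fst q) \<and> weak_le (snd p) (snd q))) z = 0"
    by (simp add: zeta2_def)
qed simp

lemma zeta2_tensor: "zeta2 P Q (tensor x y) = zeta P x * zeta Q y"
  by (simp add: zeta2_def zeta_def pairing_tensor of_bool_conj pairing_mult_left pairing_mult_right)

lemma zeta_empty_matroid: "zeta M (Poly_Mapping.single empty_matroid 1) = of_bool (weak_le empty_matroid M)"
  by (simp add: zeta_def)

lemma weak_le_empty_matroid_iff: "M \<in> matroids X \<Longrightarrow> weak_le M empty_matroid \<longleftrightarrow> ground M = {}"
  using matroid.eq_empty_matroid_iff[of M] by (auto simp: matroids_def weak_le_def)

lemma empty_matroid_weak_le_iff: "M \<in> matroids X \<Longrightarrow> weak_le empty_matroid M \<longleftrightarrow> ground M = {}"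
  using matroid.eq_empty_matroid_iff[of M] by (auto simp: matroids_def weak_le_def)

lemma counit_eq_zeta: "x \<in> coalgebra_space X \<Longrightarrow> counit x = zeta empty_matroid x"
  unfolding counit_def zeta_def pairing_def
  by (intro sum.cong) (auto simp: mem_coalgebra_space_iff weak_le_empty_matroid_iff)

lemma keys_coproduct:
  assumes "x \<in> coalgebra_space X"
  shows "Poly_Mapping.keys (coproduct x) \<subseteq> matroids X \<times> matroids X"
  unfolding coproduct_def linear_extension_def
proof (intro keys_sum_subset order_trans[OF keys_scale] order_trans[OF keys_tensor])
  fix M A assume "M \<in> Poly_Mapping.keys x" "A \<in> Pow (ground M)"
  then show "Poly_Mapping.keys (Poly_Mapping.single (restriction M A) (1::'b)) \<times>
      Poly_Mapping.keys (Poly_Mapping.single (contraction M A) (1::'b)) \<subseteq> matroids X \<times> matroids X"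
    using assms by (auto simp: mem_coalgebra_space_iff intro: restriction_mem_matroids contraction_mem_matroids)
qed

text \<open>The weak order fixes ground sets, so only \<open>A = ground P\<close> can contribute,
  and only if the ground sets of \<open>P\<close> and \<open>Q\<close> partition that of
  \<open>N\<close>. Otherwise the right-hand side vanishes too.\<close>

lemma sum_minors_weak_le:
  fixes P Q N :: "'a matroid"
  assumes "N \<in> matroids X" "P \<in> matroids X" "Q \<in> matroids X"
  shows "(\<Sum>A\<in>Pow (ground N). of_bool (weak_le (restriction N A) P \<and> weak_le (contraction N A) Q)) =
    (if ground P \<inter> ground Q = {} then of_bool (weak_le N (free_product P Q)) -
       (if 0 < rank P \<and> rank Q < card (ground Q)
        then of_bool (weak_le N (free_product (truncation P) (elongation Q))) else 0)
     else (0 :: 'k::field))" (is "?sum = ?rhs")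
proof (cases "ground P \<inter> ground Q = {} \<and> ground N = ground P \<union> ground Q")
  case True
  then have ground: "ground P \<inter> ground Q = {}" "ground N = ground P \<union> ground Q" by auto
  have "?sum = (\<Sum>A\<in>Pow (ground N). if A = ground P then of_bool (weak_le (restriction N (ground P)) P \<and>
      weak_le (contraction N (ground P)) Q) else 0)"
    by (intro sum.cong) (auto simp: weak_le_def)
  also have "\<dots> = of_bool (weak_le (restriction N (ground P)) P \<and> weak_le (contraction N (ground P)) Q)"
  proof -
    have "finite (Pow (ground N))" using assms(1) by (simp add: matroids_def matroid.finite_ground)
    moreover have "ground P \<in> Pow (ground N)" using ground by simp
    ultimately show ?thesis by (simp only: sum.delta if_True)
  qed
  \<comment> \<open>The pair of minors lies below \<open>P\<close> and \<open>Q\<close> iff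
    \<open>N\<close> lies below the free product without a rank drop; the subtracted term removes
    the case of a drop.\<close>
  also have "\<dots> = ?rhs"
    using minors_weak_le_iff[of N P Q] weak_le_free_product_truncation_iff[of N P Q] assms ground
    by (auto simp: matroids_def)
  finally show ?thesis .
next
  case False
  have "?sum = 0"
    using False by (intro sum.neutral) (auto simp: weak_le_def)
  moreover have "?rhs = 0" using False by (auto simp: weak_le_def)
  ultimately show ?thesis by simp
qed

lemma zeta2_coproduct:
  assumes "x \<in> coalgebra_space X" "P \<in> matroids X" "Q \<in> matroids X"
  shows "zeta2 P Q (coproduct x) =
    (if ground P \<inter> ground Q = {} then zeta (free_product P Q) x -
       (if 0 < rank P \<and> rank Q < card (ground Q)
        then zeta (free_product (truncation P) (elongation Q)) x else 0)
     else 0)"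
proof -
  have "zeta2 P Q (coproduct x) = pairing (\<lambda>N. \<Sum>A\<in>Pow (ground N).
      of_bool (weak_le (restriction N A) P \<and> weak_le (contraction N A) Q)) x"
    by (simp add: zeta2_def coproduct_def pairing_linear_extension pairing_sum pairing_tensor)
  also have "\<dots> = pairing (\<lambda>N. if ground P \<inter> ground Q = {} then of_bool (weak_le N (free_product P Q)) -
       (if 0 < rank P \<and> rank Q < card (ground Q)
        then of_bool (weak_le N (free_product (truncation P) (elongation Q))) else 0)
     else 0) x"
    using assms by (intro pairing_cong sum_minors_weak_le) (auto simp: mem_coalgebra_space_iff)
  also have "\<dots> = (if ground P \<inter> ground Q = {} then zeta (free_product P Q) x -
       (if 0 < rank P \<and> rank Q < card (ground Q)
        then zeta (free_product (truncation P) (elongation Q)) x else 0)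
     else 0)"
    by (auto simp: zeta_def pairing_diff_left) (auto simp: pairing_def)
  finally show ?thesis .
qed

section \<open>Primitive elements as common zeros of the \<open>zeta M\<close>\<close>

lemma truncation_mem_matroids: "M \<in> matroids X \<Longrightarrow> 0 < rank M \<Longrightarrow> truncation M \<in> matroids X"
  by (auto simp: matroids_def matroid.matroid_truncation)

lemma elongation_mem_matroids:
  "M \<in> matroids X \<Longrightarrow> rank M < card (ground M) \<Longrightarrow> elongation M \<in> matroids X"
  by (auto simp: matroids_def matroid.matroid_elongation)

lemma primitive_iff_zeta:
  fixes x :: "'a matroid \<Rightarrow>\<^sub>0 'k::field"
  shows "x \<in> primitives X \<longleftrightarrow> x \<in> coalgebra_space X \<and>
     (\<forall>M \<in> matroids X - irreducible_matroids X. zeta M x = 0)"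
proof (intro iffI conjI ballI)
  assume x: "x \<in> primitives X"
  then show C: "x \<in> coalgebra_space X" by (simp add: primitives_def)
  \<comment> \<open>Both tensors in the primitivity equation have \<open>empty_matroid\<close> as a
    factor, which lies below no matroid with nonempty ground set.\<close>
  have zeta2: "zeta2 P Q (coproduct x) = 0"
    if "P \<in> matroids X" "Q \<in> matroids X" "ground P \<noteq> {}" "ground Q \<noteq> {}" for P Q
    using x that
    by (simp add: primitives_def zeta2_tensor zeta2_add zeta_empty_matroid
        empty_matroid_weak_le_iff[of _ X])
  have prod: "zeta (free_product P Q) x = 0"
    if "P \<in> matroids X" "Q \<in> matroids X" "ground P \<noteq> {}" "ground Q \<noteq> {}"
      "ground P \<inter> ground Q = {}" for P Q
    using that
  \<comment> \<open>The vanishing of \<open>zeta2\<close> equates the values at the product and at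
    the truncated product. Truncation lowers \<open>rank P\<close> and keeps both ground sets; once
    no correction term is left, the value itself is 0.\<close>
  proof (induction "rank P" arbitrary: P Q rule: less_induct)
    case less
    show ?case
    proof (cases "0 < rank P \<and> rank Q < card (ground Q)")
      case True
      then have "rank (truncation P) < rank P"
        using less.prems(1) matroid.rank_truncation[of P] by (auto simp: matroids_def)
      then have "zeta (free_product (truncation P) (elongation Q)) x = 0"
        using less.prems True
        by (intro less.hyps) (auto intro: truncation_mem_matroids elongation_mem_matroids)
      then show ?thesis
        using zeta2_coproduct[OF C less.prems(1,2)] zeta2 less.prems True by simp
    next
      case False
      then show ?thesis
        using zeta2_coproduct[OF C less.prems(1,2)] zeta2 less.prems by auto
    qed
  qed
  fix M assume M: "M \<in> matroids X - irreducible_matroids X"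
  show "zeta M x = 0"
  proof (cases "ground M = {}")
    case True
    then have "M = empty_matroid"
      using M matroid.eq_empty_matroid_iff by (auto simp: matroids_def)
    then show ?thesis using x counit_eq_zeta[OF C] by (simp add: primitives_def)
  next
    case False
    then obtain P Q where "P \<in> matroids X" "Q \<in> matroids X" "ground P \<noteq> {}" "ground Q \<noteq> {}"
      "ground P \<inter> ground Q = {}" "M = free_product P Q"
      using M by (auto simp: irreducible_matroids_def)
    then show ?thesis using prod by simp
  qed
next
  assume x: "x \<in> coalgebra_space X \<and> (\<forall>M \<in> matroids X - irreducible_matroids X. zeta M x = 0)"
  then have C: "x \<in> coalgebra_space X" by simp
  let ?one = "Poly_Mapping.single empty_matroid 1 :: 'a matroid \<Rightarrow>\<^sub>0 'k"
  have empty: "zeta empty_matroid x = 0"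
    using x empty_matroid_mem[of X] by (simp add: irreducible_matroids_def)
  have prod: "zeta (free_product P Q) x = 0"
    if "P \<in> matroids X" "Q \<in> matroids X" "ground P \<noteq> {}" "ground Q \<noteq> {}"
      "ground P \<inter> ground Q = {}" for P Q
  proof -
    have "free_product P Q \<notin> irreducible_matroids X"
      using that unfolding irreducible_matroids_def by blast
    then show ?thesis using x free_product_mem_matroids[OF that(1,2,5)] by blast
  qed
  have "coproduct x - (tensor ?one x + tensor x ?one) = 0"
  proof (rule zero_if_zeta2_zero)
    have one: "Poly_Mapping.keys ?one \<subseteq> matroids X" using empty_matroid_mem by simp
    have keys: "Poly_Mapping.keys x \<subseteq> matroids X" using C by (simp add: mem_coalgebra_space_iff)
    have "Poly_Mapping.keys (tensor ?one x) \<subseteq> matroids X \<times> matroids X"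
      "Poly_Mapping.keys (tensor x ?one) \<subseteq> matroids X \<times> matroids X"
      using one keys by (auto dest!: subsetD[OF keys_tensor] split: if_splits)
    then show "Poly_Mapping.keys (coproduct x - (tensor ?one x + tensor x ?one)) \<subseteq> matroids X \<times> matroids X"
      using keys_coproduct[OF C] Poly_Mapping.keys_add[of "tensor ?one x" "tensor x ?one"]
        keys_diff[of "coproduct x" "tensor ?one x + tensor x ?one"] by blast
    fix P Q assume PQ: "P \<in> matroids X" "Q \<in> matroids X"
    have tensors: "zeta2 P Q (coproduct x - (tensor ?one x + tensor x ?one)) =
        zeta2 P Q (coproduct x) - (of_bool (ground P = {}) * zeta Q x + zeta P x * of_bool (ground Q = {}))"
      using PQ by (simp add: zeta2_diff zeta2_add zeta2_tensor zeta_empty_matroid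
          empty_matroid_weak_le_iff[of _ X])
    have P0: "P = empty_matroid" if "ground P = {}"
      using that PQ matroid.eq_empty_matroid_iff by (auto simp: matroids_def)
    have Q0: "Q = empty_matroid" if "ground Q = {}"
      using that PQ matroid.eq_empty_matroid_iff by (auto simp: matroids_def)
    \<comment> \<open>With an empty factor the free product is the other factor and the correction
      term is absent, so the coproduct cancels against one tensor; if both are empty,
      \<open>zeta empty_matroid x = 0\<close> settles the rest. Otherwise both tensors give 0, and
      so does each term of the coproduct, being taken at a reducible matroid.\<close>
    consider "ground P = {}" | "ground P \<noteq> {}" "ground Q = {}" | "ground P \<noteq> {}" "ground Q \<noteq> {}" by blast
    then show "zeta2 P Q (coproduct x - (tensor ?one x + tensor x ?one)) = 0"
    proof cases
      case 1
      then show ?thesis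
        using P0 PQ empty free_product_empty_left[of Q]
        unfolding tensors zeta2_coproduct[OF C PQ] by (simp add: matroids_def)
    next
      case 2
      then show ?thesis
        using Q0 PQ free_product_empty_right[of P]
        unfolding tensors zeta2_coproduct[OF C PQ] by (simp add: matroids_def)
    next
      case 3
      then show ?thesis
        using PQ prod[of P Q] prod[of "truncation P" "elongation Q"]
        unfolding tensors zeta2_coproduct[OF C PQ]
        by (simp add: truncation_mem_matroids elongation_mem_matroids)
    qed
  qed
  then show "x \<in> primitives X"
    using C empty counit_eq_zeta[OF C] by (simp add: primitives_def)
qed

lemma mobius_sum:
  assumes "M \<in> matroids X" "N \<in> matroids X"
  shows "(\<Sum>L | L \<in> matroids X \<and> weak_le M L \<and> weak_le L N. mobius X M L) = of_bool (M = N)"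
proof (cases "weak_le M N")
  case le: True
  show ?thesis
  proof (cases "M = N")
    case True
    then have "{L. L \<in> matroids X \<and> weak_le M L \<and> weak_le L N} = {M}"
      using assms weak_le_antisym by auto
    moreover have "mobius X M M = 1" using assms by (subst mobius.simps) simp
    ultimately show ?thesis using True by simp
  next
    case False
    let ?I = "{L. L \<in> matroids X \<and> weak_le M L \<and> weak_le L N \<and> L \<noteq> N}"
    have "finite ?I"
      by (rule finite_subset[OF _ finite_up_set[of X M]]) (auto simp: up_set_def)
    moreover have "{L. L \<in> matroids X \<and> weak_le M L \<and> weak_le L N} = insert N ?I"
      using assms le by auto
    \<comment> \<open>The recursion defines the value at the top \<open>N\<close> as minus the sum
      over the rest of the interval.\<close>
    ultimately show ?thesis using False assms le by (simp add: mobius.simps[of X M N])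
  qed
next
  case False
  then have "{L. L \<in> matroids X \<and> weak_le M L \<and> weak_le L N} = {}" "M \<noteq> N"
    using weak_le_trans by auto
  then show ?thesis by (simp only: sum.empty) simp
qed

lemma zeta_w_element:
  assumes "M \<in> matroids X" "N \<in> matroids X"
  shows "zeta N (w_element X M) = of_bool (M = N)"
proof -
  have "zeta N (w_element X M) = (\<Sum>L\<in>up_set X M. of_int (mobius X M L) * of_bool (weak_le L N))"
    by (simp add: zeta_def w_element_def pairing_sum pairing_scale)
  also have "\<dots> = (\<Sum>L\<in>up_set X M \<inter> {L. weak_le L N}. of_int (mobius X M L))"
    by (simp add: sum.inter_restrict finite_up_set of_bool_def if_distrib cong: if_cong)
  also have "\<dots> = of_int (\<Sum>L | L \<in> matroids X \<and> weak_le M L \<and> weak_le L N. mobius X M L)"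
    unfolding of_int_sum by (rule sum.cong) (auto simp: up_set_def)
  also have "\<dots> = of_bool (M = N)" by (simp add: mobius_sum[OF assms])
  finally show ?thesis .
qed

lemma keys_w_element: "Poly_Mapping.keys (w_element X M) \<subseteq> up_set X M"
  unfolding w_element_def by (intro keys_sum_subset order_trans[OF keys_scale]) auto

lemma w_element_homogeneous: "w_element X M \<in> homogeneous_component X (ground M)"
  using keys_w_element[of X M] by (auto simp: mem_homogeneous_component_iff up_set_def weak_le_def)

lemma w_element_mem_coalgebra_space: "w_element X M \<in> coalgebra_space X"
  using keys_w_element[of X M] by (auto simp: mem_coalgebra_space_iff up_set_def)

lemma irreducible_matroids_subset: "irreducible_matroids X \<subseteq> matroids X"
  by (auto simp: irreducible_matroids_def)

lemma inj_on_w_element: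
  "inj_on (w_element X :: _ \<Rightarrow> _ \<Rightarrow>\<^sub>0 'k::field) (matroids X)"
proof (rule inj_onI)
  fix M N assume MN: "M \<in> matroids X" "N \<in> matroids X"
    and eq: "w_element X M = (w_element X N :: _ \<Rightarrow>\<^sub>0 'k)"
  have "of_bool (M = N) = zeta N (w_element X M :: _ \<Rightarrow>\<^sub>0 'k)" by (simp add: zeta_w_element[OF MN])
  also have "\<dots> = 1" by (simp add: eq zeta_w_element[OF MN(2) MN(2)])
  finally show "M = N" by simp
qed

text \<open>Applying \<open>zeta M\<close> to a linear relation isolates the coefficient of
  \<open>w_element X M\<close>. Injectivity is needed since the relation is indexed by vectors, not
  by matroids.\<close>

lemma independent_w_element:
  assumes "I \<subseteq> matroids X"
  shows "free.independent (w_element X ` I :: (_ \<Rightarrow>\<^sub>0 'k::field) set)"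
  unfolding free.dependent_explicit
proof (clarify)
  fix T :: "(_ \<Rightarrow>\<^sub>0 'k) set" and u v
  assume T: "finite T" "T \<subseteq> w_element X ` I" and sum: "(\<Sum>v\<in>T. scale (u v) v) = 0"
    and v: "v \<in> T" "u v \<noteq> 0"
  obtain M where M: "M \<in> matroids X" "v = w_element X M" using T v assms by auto
  have zeta: "zeta M w = of_bool (w = v)" if w: "w \<in> T" for w
  proof -
    obtain N where N: "N \<in> matroids X" "w = w_element X N" using T w assms by auto
    then show ?thesis
      using M N by (simp add: zeta_w_element inj_on_eq_iff[OF inj_on_w_element])
  qed
  have "0 = zeta M (\<Sum>w\<in>T. scale (u w) w)" by (simp add: sum zeta_def)
  also have "\<dots> = (\<Sum>w\<in>T. u w * zeta M w)" by (simp add: zeta_def pairing_sum pairing_scale)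
  also have "\<dots> = (\<Sum>w\<in>T. if w = v then u w else 0)" by (intro sum.cong) (auto simp: zeta)
  also have "\<dots> = u v" using T v by simp
  finally show False using v by simp
qed

text \<open>Duality dictates the coefficients \<open>zeta M x\<close>. The resulting combination has
  the same \<open>zeta\<close> values as \<open>x\<close>, and these separate points.\<close>

lemma primitive_expansion:
  assumes "x \<in> primitives X"
  shows "x \<in> free.span (w_element X ` irreducible_matroids X)"
proof -
  have C: "x \<in> coalgebra_space X" using assms by (simp add: primitives_def)
  \<comment> \<open>A finite set that contains every irreducible matroid at which
    \<open>zeta\<close> can be nonzero on \<open>x\<close>.\<close>
  define F where "F = (\<Union>N\<in>Poly_Mapping.keys x. up_set X N) \<inter> irreducible_matroids X"
  have fin: "finite F" unfolding F_def by (simp add: finite_up_set)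
  have FX: "F \<subseteq> matroids X" using irreducible_matroids_subset by (auto simp: F_def)
  define y where "y = (\<Sum>M\<in>F. scale (zeta M x) (w_element X M))"
  have y: "y \<in> free.span (w_element X ` irreducible_matroids X)"
    unfolding y_def by (intro free.span_sum free.span_scale free.span_base) (auto simp: F_def)
  have "Poly_Mapping.keys y \<subseteq> matroids X"
    unfolding y_def using w_element_mem_coalgebra_space
    by (intro keys_sum_subset order_trans[OF keys_scale]) (auto simp: mem_coalgebra_space_iff)
  then have "x - y \<in> coalgebra_space X"
    using C keys_diff[of x y] by (auto simp: mem_coalgebra_space_iff)
  moreover have "zeta N (x - y) = 0" if N: "N \<in> matroids X" for N
  proof -
    have "zeta N y = (\<Sum>M\<in>F. zeta M x * zeta N (w_element X M :: _ \<Rightarrow>\<^sub>0 'b))"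
      by (simp add: y_def zeta_def pairing_sum pairing_scale)
    also have "\<dots> = (\<Sum>M\<in>F. if M = N then zeta M x else 0)"
      using FX N by (intro sum.cong) (auto simp: zeta_w_element)
    also have "\<dots> = (if N \<in> F then zeta N x else 0)" using fin by simp
    \<comment> \<open>Outside \<open>F\<close> the value is 0: either \<open>N\<close> is
      irreducible and no key of \<open>x\<close> lies below it, or \<open>N\<close> is not
      irreducible and primitivity of \<open>x\<close> applies.\<close>
    also have "\<dots> = zeta N x"
    proof (cases "N \<in> irreducible_matroids X")
      case True
      have "zeta N x = 0" if "N \<notin> F"
        unfolding zeta_def pairing_def
        using True that N by (intro sum.neutral) (auto simp: F_def up_set_def)
      then show ?thesis by simp
    next
      case False
      then show ?thesis using assms N unfolding primitive_iff_zeta by (auto simp: F_def)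
    qed
    finally show ?thesis by (simp add: zeta_def pairing_diff)
  qed
  ultimately have "x - y = 0" by (rule zero_if_zeta_zero)
  with y show ?thesis by simp
qed

text \<open>By \<open>primitive_iff_zeta\<close>, the primitive elements are cut out of the
  coalgebra space by kernels of linear functionals.\<close>

lemma subspace_primitives: "free.subspace (primitives X)"
  unfolding free.subspace_def
proof (intro conjI ballI allI)
  show "0 \<in> primitives X"
    by (simp add: primitive_iff_zeta mem_coalgebra_space_iff zeta_def)
  show "x + y \<in> primitives X" if "x \<in> primitives X" "y \<in> primitives X" for x y :: "_ \<Rightarrow>\<^sub>0 'k::field"
    using that Poly_Mapping.keys_add[of x y]
    by (auto simp: primitive_iff_zeta mem_coalgebra_space_iff zeta_def pairing_add)
  show "scale c x \<in> primitives X" if "x \<in> primitives X" for c and x :: "_ \<Rightarrow>\<^sub>0 'k::field"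
    using that keys_scale[of c x]
    by (auto simp: primitive_iff_zeta mem_coalgebra_space_iff zeta_def pairing_scale)
qed

theorem theorem10:
  fixes X :: "'a set"
    and B :: "('a matroid \<Rightarrow>\<^sub>0 'k::field) set"
  assumes "infinite X"
    and "B = w_element X ` irreducible_matroids X"
  shows "B \<subseteq> primitives X \<and>
    free.independent B \<and>
    free.span B = primitives X \<and>
    (\<forall>b \<in> B. \<exists>S. finite S \<and> S \<subseteq> X \<and> b \<in> homogeneous_component X S)"
proof (intro conjI ballI)
  \<comment> \<open>For irreducible \<open>M\<close>, \<open>zeta N\<close> is nonzero on
    \<open>w_element X M\<close> only at \<open>N = M\<close>, so it vanishes at every
    \<open>N\<close> that is not irreducible.\<close>
  show sub: "B \<subseteq> primitives X"
    using irreducible_matroids_subset[of X] w_element_mem_coalgebra_space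
    by (auto simp: assms(2) primitive_iff_zeta zeta_w_element subset_iff)
  show "free.independent B"
    unfolding assms(2) by (rule independent_w_element[OF irreducible_matroids_subset])
  show "free.span B = primitives X"
    using primitive_expansion free.span_minimal[OF sub subspace_primitives]
    by (auto simp: assms(2))
  fix b assume "b \<in> B"
  then obtain M where "M \<in> matroids X" "b = w_element X M"
    using irreducible_matroids_subset by (auto simp: assms(2))
  then show "\<exists>S. finite S \<and> S \<subseteq> X \<and> b \<in> homogeneous_component X S"
    using w_element_homogeneous
    by (intro exI[of _ "ground M"]) (auto simp: matroids_def matroid.finite_ground)
qed

end
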